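(* Let $F\subseteq 2^\omega\times\omega^\omega$ be a closed set whose projection to the first coordinate is all of $2^\omega$ and which admits no Borel uniformization. Let $A_0$ be the family of all antichains $S\subseteq 2^{<\omega}$. Let $B$ be the family of all infinite sets $S\subseteq 2^{<\omega}$ for which there exist $f\in 2^\omega$ and $g\in\omega^\omega$ such that $S\subseteq f'$, $(f,g)\in F$ and $g\le \mathrm{Enum}(S)$. Let $\mathcal{J}$ be the ideal on $2^{<\omega}$ generated by $A_0\cup B$. Then $\mathcal{J}$ is an $F_\sigma$ tall ideal that does not admit a Borel selector.
   Context: $2^{<\omega}$ is the countable set of finite $0$-$1$ sequences, partially ordered by the initial segment relation; an antichain is a set of pairwise incomparable elements. For $f\in 2^\omega$, $f'=\{f\restriction n: n\in\omega\}\subseteq 2^{<\omega}$. For an infinite $S\subseteq f'$, $\mathrm{Enum}(S)\in\omega^\omega$ is the strictly increasing enumeration of the set of indices $\{n\in\omega: f\restriction n\in S\}$. The relation $\le$ on $\omega^\omega$ is the pointwise ordering. A set $F\subseteq 2^\omega\times\omega^\omega$ projecting onto $2^\omega$ admits a Borel uniformization if there is a Borel function $u:2^\omega\to\omega^\omega$ with $(f,u(f))\in F$ for all $f\in 2^\omega$. (Closed sets $F$ that project onto $2^\omega$ and admit no Borel uniformization are known to exist.) For a countably infinite set $X$ (here $X=2^{<\omega}$), an ideal on $X$ is a collection of subsets of $X$ that is closed under finite unions and under subsets, contains all finite subsets of $X$, and does not contain $X$. The ideal generated by a family is the smallest collection containing that family and all finite sets that is closed under subsets and finite unions. Subsets of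 $X$ are identified with their characteristic functions, so that $\mathcal{P}(X)$ is identified with $2^X$ with the product topology; "$F_\sigma$" and "Borel" refer to this topology. $[S]^\omega$ denotes the collection of countably infinite subsets of $S$. An ideal $\mathcal{I}$ on $X$ is tall if for every $x\in[X]^\omega$ there is $y\in[x]^\omega$ with $y\in\mathcal{I}$. A selector for a tall ideal $\mathcal{I}$ on $X$ is a map $\phi:[X]^\omega\to\mathcal{I}$ such that $\phi(S)\in[S]^\omega\cap\mathcal{I}$ for every $S\in[X]^\omega$; it is a Borel selector if $\phi$ is a Borel map. *)

theory Defs
  imports "HOL-Analysis.Analysis" "HOL-Library.Sublist" "HOL-Library.Infinite_Set"
begin

section \<open>Ideals on a countable set\<close>

text \<open>
  The underlying set is the universe of a countable type; the notions are meant for infinite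
  types (here bool list), where the infinite subsets are exactly the countably infinite ones.
\<close>

definition ideal_closed :: "'a::countable set set \<Rightarrow> bool" where
  "ideal_closed I \<longleftrightarrow>
     (\<forall>S. finite S \<longrightarrow> S \<in> I) \<and>
     (\<forall>S\<in>I. \<forall>T. T \<subseteq> S \<longrightarrow> T \<in> I) \<and>
     (\<forall>S\<in>I. \<forall>T\<in>I. S \<union> T \<in> I)"

definition set_ideal :: "'a::countable set set \<Rightarrow> bool" where
  "set_ideal I \<longleftrightarrow> ideal_closed I \<and> UNIV \<notin> I"

text \<open>The generated collection need not be proper, i.e.\ it may contain the whole space.\<close>

definition generated_ideal :: "'a::countable set set \<Rightarrow> 'a set set" where
  "generated_ideal G = ideal_closed hull G"

definition tall :: "'a::countable set set \<Rightarrow> bool" where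
  "tall I \<longleftrightarrow> (\<forall>x. infinite x \<longrightarrow> (\<exists>y. y \<subseteq> x \<and> infinite y \<and> y \<in> I))"

text \<open>
  The topology on the power set obtained by identifying sets with their characteristic functions;
  the function type carries the product topology of the discrete space bool.
\<close>

definition powerset_topology :: "'a::countable set topology" where
  "powerset_topology = pullback_topology UNIV (\<lambda>S x. x \<in> S) (euclidean :: ('a \<Rightarrow> bool) topology)"

definition powerset_borel :: "'a::countable set measure" where
  "powerset_borel = sigma UNIV {U. openin powerset_topology U}"

text \<open>Only the values of a selector on infinite sets are relevant.\<close>

definition selector :: "'a::countable set set \<Rightarrow> ('a set \<Rightarrow> 'a set) \<Rightarrow> bool" where
  "selector I \<phi> \<longleftrightarrow> (\<forall>S. infinite S \<longrightarrow> \<phi> S \<subseteq> S \<and> infinite (\<phi> S) \<and> \<phi> S \<in> I)"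

definition borel_selector :: "'a::countable set set \<Rightarrow> ('a set \<Rightarrow> 'a set) \<Rightarrow> bool" where
  "borel_selector I \<phi> \<longleftrightarrow> selector I \<phi> \<and>
     \<phi> \<in> restrict_space powerset_borel {S. infinite S} \<rightarrow>\<^sub>M restrict_space powerset_borel I"


section \<open>The ideal associated with a subset of the product of Cantor and Baire space\<close>

definition admits_borel_uniformization :: "((nat \<Rightarrow> bool) \<times> (nat \<Rightarrow> nat)) set \<Rightarrow> bool" where
  "admits_borel_uniformization F \<longleftrightarrow> (\<exists>u \<in> borel_measurable borel. \<forall>f. (f, u f) \<in> F)"

definition restr :: "(nat \<Rightarrow> bool) \<Rightarrow> nat \<Rightarrow> bool list" where
  "restr f n = map f [0..<n]"

definition branch :: "(nat \<Rightarrow> bool) \<Rightarrow> bool list set" where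
  "branch f = range (restr f)"

text \<open>Used only for infinite subsets S of the branch f, which determine f.\<close>

definition Enum :: "(nat \<Rightarrow> bool) \<Rightarrow> bool list set \<Rightarrow> nat \<Rightarrow> nat" where
  "Enum f S = enumerate {n. restr f n \<in> S}"

definition antichains :: "bool list set set" where
  "antichains = {S. pairwise parallel S}"

definition B_family :: "((nat \<Rightarrow> bool) \<times> (nat \<Rightarrow> nat)) set \<Rightarrow> bool list set set" where
  "B_family F = {S. infinite S \<and> (\<exists>f g. S \<subseteq> branch f \<and> (f, g) \<in> F \<and> g \<le> Enum f S)}"

definition J_ideal :: "((nat \<Rightarrow> bool) \<times> (nat \<Rightarrow> nat)) set \<Rightarrow> bool list set set" where
  "J_ideal F = generated_ideal (antichains \<union> B_family F)"

end

theory Submission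
  imports Defs "HOL-Library.Ramsey"
begin

text \<open>
  A set lies in the ideal iff it is a finite union of antichains and of sets all of whose finite
  initial segments look like initial segments of members of \<^term>\<open>B_family F\<close>. Both families are
  closed in the compact space of all subsets, so the finite unions with a given number of parts
  form a compact set and the ideal is \<open>F\<^sub>\<sigma>\<close>. It is tall by Ramsey's theorem and proper because a
  branch meets every antichain in at most one point and any other branch in a finite set.

  Given a Borel selector, let \<open>S\<close> be its value at the branch of \<open>f\<close>. Up to a finite set, \<open>S\<close> is a
  union of \<open>k\<close> pieces in \<^term>\<open>B_family F\<close>. When \<open>k\<close> is minimal, every piece of every such
  decomposition is infinite, and hence bounds some \<open>g\<close> with \<open>(f, g) \<in> F\<close>. By compactness it is a
  closed condition on \<open>S\<close> that such a \<open>g\<close> can be chosen with a prescribed initial segment, so the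
  leftmost branch of the tree of these initial segments is a Borel uniformization of \<open>F\<close>.
\<close>

section \<open>The space of subsets\<close>

lemma topspace_powerset_topology [simp]: "topspace powerset_topology = UNIV"
  by (simp add: powerset_topology_def topspace_pullback_topology)

text \<open>Transports compactness and the Hausdorff property from the product space of predicates
  to the power set.\<close>

lemma homeomorphic_map_powerset_topology:
  "homeomorphic_map powerset_topology (euclidean :: ('a::countable \<Rightarrow> bool) topology)
     (\<lambda>S x. x \<in> S)"
proof (rule homeomorphic_maps_imp_map)
  show "homeomorphic_maps powerset_topology (euclidean :: ('a \<Rightarrow> bool) topology)
      (\<lambda>S x. x \<in> S) (\<lambda>p. {x. p x})"
    unfolding homeomorphic_maps_def
  proof (intro conjI ballI)
    show "continuous_map powerset_topology euclidean (\<lambda>S x. (x::'a) \<in> S)"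
      unfolding powerset_topology_def
      using continuous_map_pullback[OF continuous_map_id, of UNIV "\<lambda>S x. x \<in> S" euclidean]
      by (simp add: o_def)
    show "continuous_map (euclidean :: ('a \<Rightarrow> bool) topology) powerset_topology (\<lambda>p. {x. p x})"
      unfolding powerset_topology_def
      by (rule continuous_map_pullback') (auto simp: o_def)
  qed auto
qed

lemma compact_space_powerset_topology:
  "compact_space (powerset_topology :: 'a::countable set topology)"
proof -
  have "compact_space (product_topology (\<lambda>_::'a. euclidean :: bool topology) UNIV)"
    using finite_imp_compactin[of UNIV "euclidean :: bool topology"]
    by (simp add: compact_space_product_topology) (simp add: compact_space_def)
  then show ?thesis
    unfolding euclidean_product_topology
    by (rule homeomorphic_compact_space[OF homeomorphic_map_imp_homeomorphic_space, THEN iffD2,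
          OF homeomorphic_map_powerset_topology])
qed

lemma Hausdorff_space_powerset_topology:
  "Hausdorff_space (powerset_topology :: 'a::countable set topology)"
proof -
  have "(euclidean :: bool topology) = discrete_topology UNIV"
    by (simp add: topology_eq open_discrete)
  then have "Hausdorff_space (product_topology (\<lambda>_::'a. euclidean :: bool topology) UNIV)"
    by (simp add: Hausdorff_space_product_topology)
  then show ?thesis
    unfolding euclidean_product_topology
    by (rule homeomorphic_Hausdorff_space[OF homeomorphic_map_imp_homeomorphic_space, THEN iffD2,
          OF homeomorphic_map_powerset_topology])
qed

lemma continuous_map_into_powerset_topology:
  assumes "\<And>x. continuous_map X euclidean (\<lambda>a. x \<in> f a)"
  shows "continuous_map X powerset_topology f"
  unfolding powerset_topology_def
proof (rule continuous_map_pullback')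
  have "continuous_map X (product_topology (\<lambda>_. euclidean) UNIV) (\<lambda>a x. x \<in> f a)"
    using assms by (simp add: continuous_map_componentwise_UNIV)
  then show "continuous_map X euclidean ((\<lambda>S x. x \<in> S) \<circ> f)"
    by (simp add: euclidean_product_topology o_def)
qed auto

lemma continuous_map_mem_powerset_topology:
  "continuous_map (powerset_topology :: 'a::countable set topology) euclidean (\<lambda>S. x \<in> S)"
proof -
  have "continuous_map powerset_topology euclidean (\<lambda>S (x::'a). x \<in> S)"
    using homeomorphic_map_powerset_topology homeomorphic_imp_continuous_map by blast
  then show ?thesis
    unfolding euclidean_product_topology[symmetric] by (simp add: continuous_map_componentwise_UNIV)
qed

text \<open>\<open>bool\<close> is discrete, so a preimage splits into the open pieces where
  \<open>p a = b\<close> and \<open>q a = c\<close>; any connective \<open>h\<close> is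
  allowed.\<close>

lemma continuous_map_bool_connective:
  fixes p q :: "'a \<Rightarrow> bool"
  assumes "continuous_map X euclidean p" "continuous_map X euclidean q"
  shows "continuous_map X euclidean (\<lambda>a. h (p a) (q a))"
proof -
  have open_bool: "open (U :: bool set)" for U
    by (simp add: open_discrete)
  have "openin X {a \<in> topspace X. h (p a) (q a) \<in> U}" for U
  proof -
    have "{a \<in> topspace X. h (p a) (q a) \<in> U} =
        (\<Union>(b, c)\<in>{(b, c). h b c \<in> U}. {a \<in> topspace X. p a \<in> {b}} \<inter> {a \<in> topspace X. q a \<in> {c}})"
      by auto
    moreover have "openin X {a \<in> topspace X. p a \<in> {b}}" "openin X {a \<in> topspace X. q a \<in> {c}}" for b c
      using assms[THEN openin_continuous_map_preimage] open_bool by (simp_all only: open_openin)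
    ultimately show ?thesis
      by (auto intro!: openin_Union)
  qed
  then show ?thesis
    by (simp add: continuous_map_def)
qed

section \<open>Closed families and unions of finitely many members\<close>

definition join :: "'a set set \<Rightarrow> 'a set set \<Rightarrow> 'a set set" where
  "join X Y = {S \<union> T |S T. S \<in> X \<and> T \<in> Y}"

text \<open>Union is continuous on pairs, so the join is the image of a compact set, and compact
  sets are closed in a Hausdorff space.\<close>

lemma closedin_join:
  assumes "closedin powerset_topology X" "closedin powerset_topology (Y :: 'a::countable set set)"
  shows "closedin powerset_topology (join X Y)"
proof -
  have "continuous_map (prod_topology powerset_topology powerset_topology) powerset_topology
      (\<lambda>p :: 'a set \<times> 'a set. fst p \<union> snd p)"
    using continuous_map_bool_connective[where h = "(\<or>)",
        OF continuous_map_compose[OF continuous_map_fst continuous_map_mem_powerset_topology]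
          continuous_map_compose[OF continuous_map_snd continuous_map_mem_powerset_topology]]
    by (intro continuous_map_into_powerset_topology) (simp add: o_def)
  moreover have "compactin (prod_topology powerset_topology powerset_topology) (X \<times> Y)"
    using assms by (simp add: compactin_Times closedin_compact_space[OF compact_space_powerset_topology])
  ultimately have "compactin powerset_topology ((\<lambda>p. fst p \<union> snd p) ` (X \<times> Y))"
    by (rule image_compactin[rotated])
  moreover have "(\<lambda>p. fst p \<union> snd p) ` (X \<times> Y) = join X Y"
  proof -
    have "S \<union> T \<in> (\<lambda>p. fst p \<union> snd p) ` (X \<times> Y)" if "S \<in> X" "T \<in> Y" for S T
      using that by (intro image_eqI[of _ _ "(S, T)"]) auto
    moreover have "fst p \<union> snd p \<in> join X Y" if "p \<in> X \<times> Y" for p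
      unfolding join_def using that by (intro CollectI exI conjI) auto
    ultimately show ?thesis
      by (auto simp: join_def)
  qed
  ultimately show ?thesis
    using compactin_imp_closedin[OF Hausdorff_space_powerset_topology] by simp
qed

text \<open>Each condition reads only a finite window, so it is a finite union of closed sets that
  fix \<open>S \<inter> L n\<close>. Antichains and bounded chains are later presented in this
  form.\<close>

lemma closedin_locally_determined:
  assumes "\<And>n. finite (L n)"
  shows "closedin powerset_topology {S :: 'a::countable set. \<forall>n. Q n (S \<inter> L n)}"
proof -
  have mem: "closedin powerset_topology {S. x \<in> S \<longleftrightarrow> b}" for x :: 'a and b
    using closedin_continuous_map_preimage[OF continuous_map_mem_powerset_topology, of "{b}" x]
    by (simp add: closed_def open_discrete)
  have "closedin powerset_topology {S. Q n (S \<inter> L n)}" for n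
  proof -
    have "closedin powerset_topology {S. S \<inter> L n = E}" if "E \<subseteq> L n" for E
    \<comment> \<open>For an empty window the intersection below would range over no sets, so that
      case is split off.\<close>
    proof (cases "L n = {}")
      case False
      have "{S. S \<inter> L n = E} = (\<Inter>x\<in>L n. {S. x \<in> S \<longleftrightarrow> x \<in> E})"
        using that by blast
      then show ?thesis
        using mem False by (auto intro!: closedin_Inter)
    qed (use that closedin_topspace[of powerset_topology] in auto)
    moreover have "{S. Q n (S \<inter> L n)} = (\<Union>E\<in>{E \<in> Pow (L n). Q n E}. {S. S \<inter> L n = E})"
      by auto
    ultimately show ?thesis
      using assms by (auto intro!: closedin_Union)
  qed
  moreover have "{S. \<forall>n. Q n (S \<inter> L n)} = (\<Inter>n. {S. Q n (S \<inter> L n)})"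
    by auto
  ultimately show ?thesis
    by (auto intro!: closedin_Inter)
qed

text \<open>The base \<open>A\<close> is an error term: \<open>A = {}\<close> gives plain unions of
  \<open>k\<close> members of \<open>D\<close>, while \<open>A = lev N\<close> tolerates a finite
  error.\<close>

definition unions :: "'a::countable set set \<Rightarrow> 'a set \<Rightarrow> nat \<Rightarrow> 'a set set" where
  "unions D A k = (join D ^^ k) (Pow A)"

lemma unions_0 [simp]: "unions D A 0 = Pow A"
  by (simp add: unions_def)

lemma unions_Suc: "unions D A (Suc k) = {S \<union> T |S T. S \<in> D \<and> T \<in> unions D A k}"
  by (simp add: unions_def join_def)

lemma closedin_unions:
  assumes "closedin powerset_topology D"
  shows "closedin powerset_topology (unions D A k)"
proof (induction k)
  case 0
  \<comment> \<open>Windows with the single point \<open>from_nat n\<close> cover the countable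
    type, which makes \<open>Pow A\<close> locally determined.\<close>
  have "S \<subseteq> A" if "\<And>n. S \<inter> {from_nat n} \<subseteq> A" for S
  proof
    fix x
    assume "x \<in> S"
    then show "x \<in> A"
      using that[of "to_nat x"] by simp
  qed
  then have "Pow A = {S. \<forall>n. S \<inter> {from_nat n} \<subseteq> A}"
    by blast
  then show ?case
    using closedin_locally_determined[of "\<lambda>n. {from_nat n}" "\<lambda>_ S. S \<subseteq> A"] by simp
next
  case (Suc k)
  then show ?case
    using closedin_join[OF assms] by (simp add: unions_def)
qed

lemma unions_mono:
  assumes "\<forall>S\<in>D. Pow S \<subseteq> D"
  shows "S \<in> unions D A k \<Longrightarrow> T \<subseteq> S \<Longrightarrow> T \<in> unions D A k"
proof (induction k arbitrary: S T)
  case (Suc k)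
  then obtain P Q where PQ: "S = P \<union> Q" "P \<in> D" "Q \<in> unions D A k"
    by (auto simp: unions_Suc)
  have "T \<inter> P \<in> D" "T \<inter> Q \<in> unions D A k"
    using assms PQ(2) Suc.IH[OF PQ(3)] by auto
  moreover have "T = (T \<inter> P) \<union> (T \<inter> Q)"
    using PQ(1) Suc.prems(2) by blast
  ultimately show ?case
    unfolding unions_Suc by blast
qed auto

text \<open>The extra set \<open>T\<close> is absorbed by the base, so the number of parts stays
  \<open>k\<close>. The minimality argument for selectors rests on this.\<close>

lemma unions_Un_base:
  assumes "S \<in> unions D A k" "T \<subseteq> A'" "A \<subseteq> A'"
  shows "T \<union> S \<in> unions D A' k"
  using assms(1)
proof (induction k arbitrary: S)
  case (Suc k)
  then obtain P Q where PQ: "S = P \<union> Q" "P \<in> D" "Q \<in> unions D A k"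
    by (auto simp: unions_Suc)
  have "T \<union> Q \<in> unions D A' k"
    using Suc.IH PQ(3) by blast
  moreover have "T \<union> S = P \<union> (T \<union> Q)"
    using PQ(1) by blast
  ultimately show ?case
    using PQ(2) unfolding unions_Suc by blast
qed (use assms in auto)

lemma unions_Un:
  assumes "S \<in> unions D A k" "T \<in> unions D A l"
  shows "S \<union> T \<in> unions D A (k + l)"
  using assms(1)
proof (induction k arbitrary: S)
  case 0
  then show ?case
    using unions_Un_base[OF assms(2)] by simp
next
  case (Suc k)
  then obtain P Q where "S = P \<union> Q" "P \<in> D" "Q \<in> unions D A k"
    by (auto simp: unions_Suc)
  then show ?case
    using Suc.IH unfolding add_Suc unions_Suc by (auto simp: Un_assoc)
qed

lemma space_powerset_borel [simp]: "space powerset_borel = UNIV"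
  by (simp add: powerset_borel_def)

lemma closedin_imp_sets_powerset_borel:
  assumes "closedin powerset_topology Z"
  shows "Z \<in> sets powerset_borel"
proof -
  have "- Z \<in> sets powerset_borel"
    using assms by (auto simp: powerset_borel_def closedin_def Compl_eq_Diff_UNIV)
  then show ?thesis
    using sets.compl_sets[of "- Z" powerset_borel] by (simp add: Diff_eq)
qed

section \<open>Sequences and leftmost branches\<close>

text \<open>A diagonal argument: \<open>A m\<close> is a decreasing chain of infinite index sets,
  and passing to \<open>A (Suc m)\<close> freezes coordinate \<open>m\<close> by the pigeonhole
  principle. Indices below \<open>N\<close> are dropped first, since only the tail has finitely many
  values.\<close>

lemma agreeing_subsequence:
  fixes h :: "nat \<Rightarrow> nat \<Rightarrow> 'a"
  assumes "\<And>i. \<exists>N. finite ((\<lambda>n. h n i) ` {N..})"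
  obtains w where "\<And>m. infinite {n. \<forall>i<m. h n i = w i}"
proof -
  have "\<exists>A. \<forall>m. infinite (A m) \<and> (A (Suc m) \<subseteq> A m \<and> (\<exists>v. \<forall>n\<in>A (Suc m). h n m = v))"
  proof (rule dependent_nat_choice)
    fix A :: "nat set" and m
    assume A: "infinite A"
    obtain N where N: "finite ((\<lambda>n. h n m) ` {N..})"
      using assms by blast
    have "infinite (A \<inter> {N..})"
    proof
      assume "finite (A \<inter> {N..})"
      moreover have "A \<subseteq> (A \<inter> {N..}) \<union> {..<N}"
        by auto
      ultimately show False
        using A finite_subset by blast
    qed
    moreover have "finite ((\<lambda>n. h n m) ` (A \<inter> {N..}))"
      using N by (rule finite_subset[rotated]) auto
    ultimately obtain a where "infinite {n \<in> A \<inter> {N..}. h n m = h a m}"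
      using pigeonhole_infinite[of "A \<inter> {N..}" "\<lambda>n. h n m"] by blast
    then show "\<exists>B. infinite B \<and> B \<subseteq> A \<and> (\<exists>v. \<forall>n\<in>B. h n m = v)"
      by (intro exI[of _ "{n \<in> A \<inter> {N..}. h n m = h a m}"]) auto
  qed (auto intro: infinite_UNIV_nat)
  then obtain A where inf: "\<And>m. infinite (A m)" and sub: "\<And>m. A (Suc m) \<subseteq> A m"
    and "\<And>m. \<exists>v. \<forall>n\<in>A (Suc m). h n m = v"
    by blast
  then have "\<exists>w. \<forall>m. \<forall>n\<in>A (Suc m). h n m = w m"
    by (intro choice) blast
  then obtain w where w: "\<And>m n. n \<in> A (Suc m) \<Longrightarrow> h n m = w m"
    by blast
  have "infinite {n. \<forall>i<m. h n i = w i}" for m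
  proof (rule infinite_super[OF _ inf[of m]])
    have "A m \<subseteq> A (Suc i)" if "i < m" for i
      using lift_Suc_antimono_le[of A "Suc i" m] sub that by simp
    then show "A m \<subseteq> {n. \<forall>i<m. h n i = w i}"
      using w by blast
  qed
  then show ?thesis
    using that by blast
qed

lemma tendsto_of_agreement:
  fixes x :: "nat \<Rightarrow> nat \<Rightarrow> 'a::topological_space"
  assumes "\<And>n i. i < n \<Longrightarrow> x n i = y i"
  shows "x \<longlonglongrightarrow> y"
proof -
  have "limitin euclidean (\<lambda>n. x n i) (y i) sequentially" for i
    by (auto intro!: tendsto_eventually eventually_sequentiallyI[of "Suc i"] assms)
  then have "limitin (product_topology (\<lambda>_. euclidean) UNIV) x y sequentially"
    by (simp add: limitin_componentwise)
  then show ?thesis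
    by (simp add: euclidean_product_topology)
qed

text \<open>Pairs that agree with \<open>(f, g)\<close> on longer and longer initial segments
  converge to it in the product topology.\<close>

lemma closed_agreement:
  fixes F :: "((nat \<Rightarrow> 'a::topological_space) \<times> (nat \<Rightarrow> 'b::topological_space)) set"
  assumes "closed F"
    and "\<And>n. \<exists>(f', g')\<in>F. \<forall>i<n. f' i = f i \<and> g' i = g i"
  shows "(f, g) \<in> F"
proof -
  obtain x where x: "\<And>n. x n \<in> F" "\<And>n i. i < n \<Longrightarrow> fst (x n) i = f i \<and> snd (x n) i = g i"
    using assms(2) by (simp add: case_prod_unfold) metis
  then have "(\<lambda>n. (fst (x n), snd (x n))) \<longlonglongrightarrow> (f, g)"
    by (intro tendsto_Pair tendsto_of_agreement) auto
  then show ?thesis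
    using Lim_in_closed_set[OF assms(1), of x sequentially] x(1) by simp
qed

text \<open>The leftmost branch through the good nodes is measurable because each node ranges over a
  countable type and each new entry is a least number with a measurable property.\<close>

lemma measurable_leaf:
  fixes good :: "'a \<Rightarrow> nat list \<Rightarrow> bool"
  assumes meas: "\<And>s. Measurable.pred M (\<lambda>x. good x s)"
    and Nil: "\<And>x. good x []"
    and snoc: "\<And>x s. good x s \<Longrightarrow> \<exists>j. good x (s @ [j])"
  obtains u :: "'a \<Rightarrow> nat \<Rightarrow> nat"
  where "u \<in> borel_measurable M" "\<And>x n. good x (map (u x) [0..<n])"
proof
  \<comment> \<open>\<open>v x n\<close> is the node of length \<open>n\<close> on the leftmost
    branch, and \<open>u x n\<close> is the entry that extends it.\<close>
  define v where "v x = rec_nat [] (\<lambda>n s. s @ [LEAST j. good x (s @ [j])])" for x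
  define u where "u x n = (LEAST j. good x (v x n @ [j]))" for x n
  have v_simps: "v x 0 = []" "v x (Suc n) = v x n @ [u x n]" for x n
    by (simp_all add: v_def u_def)
  have v_eq: "v x n = map (u x) [0..<n]" for x n
    by (induction n) (simp_all add: v_simps)
  have "good x (v x n)" for x n
  proof (induction n)
    case (Suc n)
    then show ?case
      using snoc LeastI_ex[of "\<lambda>j. good x (v x n @ [j])"] by (simp add: v_simps u_def)
  qed (simp add: v_simps Nil)
  then show "good x (map (u x) [0..<n])" for x n
    by (simp add: v_eq)
  have Least: "(\<lambda>x. LEAST j. good x (s @ [j])) \<in> M \<rightarrow>\<^sub>M count_space UNIV" for s
    using meas by (intro measurable_Least)
  have v_meas: "(\<lambda>x. v x n) \<in> M \<rightarrow>\<^sub>M count_space UNIV" for n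
  proof (induction n)
    case (Suc n)
    \<comment> \<open>The node is first held fixed as \<open>s\<close>; the countably valued
      \<open>v x n\<close> is substituted for it afterwards.\<close>
    have "(\<lambda>x. s @ [LEAST j. good x (s @ [j])]) \<in> M \<rightarrow>\<^sub>M count_space UNIV" for s
      using measurable_compose[OF Least[of s], of "\<lambda>j. s @ [j]"] by simp
    from measurable_compose_countable[OF this Suc] show ?case
      by (simp add: v_simps u_def)
  qed (simp add: v_simps)
  have "(\<lambda>x. u x n) \<in> M \<rightarrow>\<^sub>M count_space UNIV" for n
    unfolding u_def using measurable_compose_countable[OF Least v_meas] .
  then have "(\<lambda>x. u x n) \<in> borel_measurable M" for n
    by (rule measurable_compose) simp
  then show "u \<in> borel_measurable M"
    by (rule measurable_coordinatewise_then_product)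
qed

section \<open>Branches and antichains of the binary tree\<close>

text \<open>Finite windows exhausting the tree; they also serve as the finite errors in
  \<open>unions\<close>.\<close>

definition lev :: "nat \<Rightarrow> bool list set" where
  "lev n = {x. length x < n}"

lemma finite_lev: "finite (lev n)"
proof -
  have "lev n = {x. set x \<subseteq> UNIV \<and> length x < n}"
    by (auto simp: lev_def)
  then show ?thesis
    using finite_lists_length_le[of "UNIV :: bool set" n] by (auto elim: finite_subset[rotated])
qed

lemma finite_subset_lev:
  assumes "finite S"
  obtains n where "S \<subseteq> lev n"
proof
  \<comment> \<open>For empty \<open>S\<close> the value of \<open>Max\<close> is unspecified, but
    the inclusion is trivial.\<close>
  show "S \<subseteq> lev (Suc (Max (length ` S)))"
    using assms by (auto simp: lev_def less_Suc_eq_le)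
qed

lemma infinite_longer:
  assumes "infinite (S :: bool list set)"
  obtains x where "x \<in> S" "n \<le> length x"
proof -
  have "\<not> S \<subseteq> lev n"
    using assms finite_lev finite_subset by blast
  then obtain x where "x \<in> S" "x \<notin> lev n"
    by blast
  then show ?thesis
    using that by (simp add: lev_def)
qed

lemma length_restr [simp]: "length (restr f n) = n"
  by (simp add: restr_def)

lemma inj_restr: "inj (restr f)"
  by (rule injI) (metis length_restr)

lemma branch_iff: "x \<in> branch f \<longleftrightarrow> (\<forall>i<length x. x ! i = f i)"
proof
  assume "\<forall>i<length x. x ! i = f i"
  then have "x = restr f (length x)"
    by (intro nth_equalityI) (simp_all add: restr_def)
  then show "x \<in> branch f"
    unfolding branch_def by (rule range_eqI)
qed (auto simp: branch_def restr_def)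

lemma infinite_branch: "infinite (branch f)"
  unfolding branch_def using inj_restr range_inj_infinite by blast

lemma finite_branch_inter:
  assumes "f \<noteq> g"
  shows "finite (branch f \<inter> branch g)"
proof -
  obtain i where i: "f i \<noteq> g i"
    using assms by auto
  have "branch f \<inter> branch g \<subseteq> lev (Suc i)"
    using i by (force simp: branch_iff lev_def not_less_eq)
  then show ?thesis
    using finite_lev finite_subset by blast
qed

section \<open>Comparability and Ramsey's theorem\<close>

lemma prefix_nth: "prefix x y \<Longrightarrow> i < length x \<Longrightarrow> y ! i = x ! i"
  by (auto simp: prefix_def nth_append)

lemma not_parallel_in_branch:
  assumes "x \<in> branch f" "y \<in> branch f"
  shows "\<not> parallel x y"
proof -
  have "prefix x y" if "length x \<le> length y" "x \<in> branch f" "y \<in> branch f" for x y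
  proof -
    have "x = take (length x) y"
      using that by (auto simp: branch_iff list_eq_iff_nth_eq)
    then show ?thesis
      by (metis take_is_prefix)
  qed
  then show ?thesis
    using assms by (meson nle_le parallel_def)
qed

text \<open>Bit \<open>i\<close> of the branch is read off an element \<open>z i\<close> of
  \<open>S\<close> longer than \<open>i\<close>. Every \<open>x\<close> in \<open>S\<close> is
  comparable with \<open>z i\<close>, so it has the same bit wherever it is long enough.\<close>

lemma infinite_chain_subset_branch:
  assumes "infinite S" "\<And>x y. x \<in> S \<Longrightarrow> y \<in> S \<Longrightarrow> x \<noteq> y \<Longrightarrow> \<not> parallel x y"
  obtains f where "S \<subseteq> branch f"
proof -
  have "\<exists>z. \<forall>i. z i \<in> S \<and> i < length (z i)"
    by (intro choice allI) (metis infinite_longer[OF assms(1)] Suc_le_lessD)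
  then obtain z where z: "\<And>i. z i \<in> S" "\<And>i. i < length (z i)"
    by metis
  have "x ! i = z i ! i" if "x \<in> S" "i < length x" for x i
    using assms(2)[OF that(1) z(1)[of i]] prefix_nth that z(2) by (metis parallelI)
  then have "S \<subseteq> branch (\<lambda>i. z i ! i)"
    by (auto simp: branch_iff)
  then show ?thesis
    using that by blast
qed

lemma infinite_chain_or_antichain:
  assumes "infinite (X :: bool list set)"
  obtains Y where "Y \<subseteq> X" "infinite Y" "Y \<in> antichains"
    | Y f where "Y \<subseteq> X" "infinite Y" "Y \<subseteq> branch f"
proof -
  \<comment> \<open>Ramsey's theorem colours unordered pairs as sets, so incomparability is
    expressed through the set \<open>e\<close>.\<close>
  define col :: "bool list set \<Rightarrow> nat"
    where "col e = (if pairwise parallel e then 1 else 0)" for e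
  have par: "col {x, y} = (if parallel x y then 1 else 0)" if "x \<noteq> y" for x y
    using that by (auto simp: col_def pairwise_def parallel_def)
  have "\<exists>Y t. Y \<subseteq> X \<and> infinite Y \<and> t < 2 \<and> (\<forall>x\<in>Y. \<forall>y\<in>Y. x \<noteq> y \<longrightarrow> col {x, y} = t)"
    using Ramsey2[OF assms, of col 2] by (simp add: col_def)
  then obtain Y t where Y: "Y \<subseteq> X" "infinite Y" and "\<forall>x\<in>Y. \<forall>y\<in>Y. x \<noteq> y \<longrightarrow> col {x, y} = t"
    by (elim exE conjE)
  then have "col {x, y} = t" if "x \<in> Y" "y \<in> Y" "x \<noteq> y" for x y
    using that by blast
  then have t: "parallel x y \<longleftrightarrow> t = 1" if "x \<in> Y" "y \<in> Y" "x \<noteq> y" for x y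
    using par[OF that(3)] that by (metis zero_neq_one)
  show ?thesis
  proof (cases "t = 1")
    case True
    then have "parallel x y" if "x \<in> Y" "y \<in> Y" "x \<noteq> y" for x y
      using t that by blast
    then have "Y \<in> antichains"
      by (simp add: antichains_def pairwise_def)
    then show ?thesis
      using that(1) Y by blast
  next
    case False
    then have "\<not> parallel x y" if "x \<in> Y" "y \<in> Y" "x \<noteq> y" for x y
      using t that by blast
    then obtain f where "Y \<subseteq> branch f"
      using infinite_chain_subset_branch[OF Y(2)] by blast
    then show ?thesis
      using that(2) Y by blast
  qed
qed

lemma antichains_mono: "S \<in> antichains \<Longrightarrow> T \<subseteq> S \<Longrightarrow> T \<in> antichains"
  using pairwise_subset unfolding antichains_def by blast

text \<open>A violation involves two nodes only and is visible in any window containing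
  both.\<close>

lemma closedin_antichains: "closedin powerset_topology antichains"
proof -
  have "pairwise parallel S" if *: "\<And>n. pairwise parallel (S \<inter> lev n)" for S
    unfolding pairwise_def
  proof (intro ballI impI)
    fix x y
    assume "x \<in> S" "y \<in> S" "x \<noteq> y"
    then show "parallel x y"
      using *[of "Suc (length x + length y)"] by (simp add: pairwise_def lev_def)
  qed
  then have "antichains = {S. \<forall>n. pairwise parallel (S \<inter> lev n)}"
    unfolding antichains_def by (metis Int_lower1 pairwise_subset)
  then show ?thesis
    using closedin_locally_determined[of lev "\<lambda>_. pairwise parallel"] finite_lev by simp
qed

lemma finite_antichain_inter_branch:
  assumes "S \<in> antichains"
  shows "finite (S \<inter> branch f)"
proof (cases "S \<inter> branch f = {}")
  case False
  then obtain x where x: "x \<in> S" "x \<in> branch f"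
    by blast
  then have "S \<inter> branch f \<subseteq> {x}"
    using assms not_parallel_in_branch by (fastforce simp: antichains_def pairwise_def)
  then show ?thesis
    by (rule finite_subset) simp
qed simp

text \<open>Whether \<open>x\<close> lies on \<open>branch f\<close> depends on the first
  \<open>length x\<close> values of \<open>f\<close>, so the map is even continuous.\<close>

lemma measurable_branch: "branch \<in> borel \<rightarrow>\<^sub>M powerset_borel"
proof -
  have "continuous_map euclidean powerset_topology branch"
  proof (rule continuous_map_into_powerset_topology)
    fix x :: "bool list"
    have "continuous_map euclidean euclidean (\<lambda>f. \<forall>i<n. x ! i = f i)" for n
    proof (induction n)
      case (Suc n)
      have "continuous_map euclidean euclidean (\<lambda>f :: nat \<Rightarrow> bool. f n)"
        by (simp add: continuous_on_product_coordinates)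
      from continuous_map_bool_connective[OF Suc this, of "\<lambda>p b. x ! n = b \<and> p"] show ?case
        by (simp add: All_less_Suc)
    qed simp
    then show "continuous_map euclidean euclidean (\<lambda>f. x \<in> branch f)"
      by (simp add: branch_iff)
  qed
  then have "open (branch -` U)" if "openin powerset_topology U" for U
    using openin_continuous_map_preimage that by (fastforce simp: vimage_def)
  then show ?thesis
    unfolding powerset_borel_def by (intro measurable_measure_of) auto
qed

section \<open>Chains bounded from below\<close>

text \<open>
  Imposing the bound for all smaller indices as well makes the notion hereditary although \<^term>\<open>g\<close>
  need not be monotone.
\<close>

definition dominated :: "(nat \<Rightarrow> nat) \<Rightarrow> bool list set \<Rightarrow> bool" where
  "dominated g S \<longleftrightarrow> (\<forall>x\<in>S. \<forall>i\<le>card {y \<in> S. length y < length x}. g i \<le> length x)"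

lemma finite_shorter: "finite {y \<in> S. length y < n}" for S :: "bool list set"
  by (rule finite_subset[OF _ finite_lev[of n]]) (auto simp: lev_def)

lemma dominated_mono:
  assumes "dominated g S" "T \<subseteq> S"
  shows "dominated g T"
  unfolding dominated_def
proof (intro ballI allI impI)
  fix x i
  assume x: "x \<in> T" and i: "i \<le> card {y \<in> T. length y < length x}"
  have "card {y \<in> T. length y < length x} \<le> card {y \<in> S. length y < length x}"
    using assms(2) by (intro card_mono finite_shorter) auto
  then show "g i \<le> length x"
    using assms x i unfolding dominated_def by (meson in_mono order_trans)
qed

lemma dominated_inter_lev:
  assumes "dominated g (S \<inter> lev n)" "x \<in> S" "length x < n" "i \<le> card {y \<in> S. length y < length x}"
  shows "g i \<le> length x"
proof -
  have "{y \<in> S \<inter> lev n. length y < length x} = {y \<in> S. length y < length x}"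
    using assms(3) by (auto simp: lev_def)
  moreover have "x \<in> S \<inter> lev n"
    using assms(2,3) by (simp add: lev_def)
  ultimately show ?thesis
    using assms(1,4) by (simp add: dominated_def)
qed

lemma card_less_enumerate:
  fixes N :: "nat set"
  assumes "infinite N"
  shows "card {m \<in> N. m < enumerate N n} = n"
proof -
  have "{m \<in> N. m < enumerate N n} = enumerate N ` {..<n}"
    using assms enumerate_Ex by (force simp: enumerate_in_set)
  then show ?thesis
    using inj_enumerate[OF assms] by (simp add: card_image inj_on_def)
qed

text \<open>The node of \<open>S\<close> at level \<open>enumerate N j\<close> has exactly
  \<open>j\<close> shorter ones in \<open>S\<close>. Since \<open>enumerate N\<close> is increasing,
  the bounds for \<open>i \<le> j\<close> follow from those with \<open>i = j\<close>.\<close>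

lemma dominated_iff_le_Enum:
  assumes "infinite S" "S \<subseteq> branch f"
  shows "dominated g S \<longleftrightarrow> g \<le> Enum f S"
proof -
  define N where "N = {n. restr f n \<in> S}"
  have S: "S = restr f ` N"
    using assms(2) by (auto simp: N_def branch_def)
  then have N: "infinite N"
    using assms(1) by auto
  have card: "card {y \<in> S. length y < enumerate N j} = j" for j
  proof -
    have "{y \<in> S. length y < enumerate N j} = restr f ` {m \<in> N. m < enumerate N j}"
      by (auto simp: S)
    then show ?thesis
      using card_less_enumerate[OF N] inj_restr by (metis card_image subset_UNIV inj_on_subset)
  qed
  have "S = restr f ` range (enumerate N)"
    using range_enumerate[OF N] S by simp
  then have "(\<forall>x\<in>S. P x) \<longleftrightarrow> (\<forall>j. P (restr f (enumerate N j)))" for P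
    by auto
  then have "dominated g S \<longleftrightarrow> (\<forall>j. \<forall>i\<le>j. g i \<le> enumerate N j)"
    unfolding dominated_def by (simp add: card)
  also have "\<dots> \<longleftrightarrow> (\<forall>i. g i \<le> enumerate N i)"
    using N by (meson enumerate_mono_le_iff order_refl order_trans)
  finally show ?thesis
    by (simp add: le_fun_def Enum_def N_def)
qed

text \<open>Thins out \<open>Y\<close>: the levels \<open>s n\<close> are chosen increasing and
  above \<open>g n\<close>. The \<open>n\<close>-th node kept then has \<open>n\<close> shorter
  ones, and \<open>g i \<le> s i \<le> s n\<close> for \<open>i \<le> n\<close>.\<close>

lemma exists_dominated_subset:
  assumes "infinite Y" "Y \<subseteq> branch f"
  obtains S where "S \<subseteq> Y" "infinite S" "dominated g S"
proof -
  define N where "N = {n. restr f n \<in> Y}"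
  have "Y = restr f ` N"
    using assms(2) by (auto simp: N_def branch_def)
  then have N: "infinite N"
    using assms(1) by auto
  have "\<exists>s. \<forall>n. (s n \<in> N \<and> g n \<le> s n) \<and> s n < s (Suc n)"
  proof (rule dependent_nat_choice)
    show "\<exists>x. x \<in> N \<and> g 0 \<le> x"
      using N unfolding infinite_nat_iff_unbounded_le by blast
    show "\<exists>y. (y \<in> N \<and> g (Suc n) \<le> y) \<and> x < y" for x n
    proof -
      obtain y where "y \<in> N" "max (g (Suc n)) (Suc x) \<le> y"
        using N unfolding infinite_nat_iff_unbounded_le by blast
      then show ?thesis
        by auto
    qed
  qed
  then obtain s where s: "\<And>n. s n \<in> N" "\<And>n. g n \<le> s n" "strict_mono s"
    by (auto simp: strict_mono_Suc_iff)
  define S where "S = range (\<lambda>n. restr f (s n))"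
  have inj: "inj (\<lambda>n. restr f (s n))"
    using s(3) inj_restr by (metis (no_types, lifting) injD injI strict_mono_imp_inj_on)
  have "dominated g S"
    unfolding dominated_def
  proof (intro ballI allI impI)
    fix x i
    assume "x \<in> S" and i: "i \<le> card {y \<in> S. length y < length x}"
    then obtain n where x: "x = restr f (s n)"
      by (auto simp: S_def)
    have "{y \<in> S. length y < length x} = (\<lambda>n. restr f (s n)) ` {..<n}"
      using s(3) by (auto simp: S_def x strict_mono_less)
    then have "i \<le> n"
      using i card_image_le[of "{..<n}" "\<lambda>n. restr f (s n)"] by simp
    then show "g i \<le> length x"
      using s(2)[of i] s(3) x by (metis length_restr order_trans strict_mono_less_eq)
  qed
  moreover have "S \<subseteq> Y"
    using s(1) by (auto simp: S_def N_def)
  moreover have "infinite S"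
    unfolding S_def using inj range_inj_infinite by blast
  ultimately show ?thesis
    using that by blast
qed

text \<open>
  Restricting to initial segments makes the family closed. For infinite sets nothing is lost by
  compactness, since \<^const>\<open>dominated\<close> bounds the possible values of \<^term>\<open>g\<close>. The list is a
  prescribed initial segment of \<^term>\<open>g\<close>.
\<close>

definition bounded_chains :: "((nat \<Rightarrow> bool) \<times> (nat \<Rightarrow> nat)) set \<Rightarrow> nat list \<Rightarrow> bool list set set" where
  "bounded_chains F s = {S. \<forall>n. \<exists>(f, g)\<in>F. S \<inter> lev n \<subseteq> branch f \<and> dominated g (S \<inter> lev n) \<and>
     (\<forall>i<length s. g i = s ! i)}"

lemma bounded_chainsI:
  assumes "(f, g) \<in> F" "S \<subseteq> branch f" "dominated g S" "\<And>i. i < length s \<Longrightarrow> g i = s ! i"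
  shows "S \<in> bounded_chains F s"
  unfolding bounded_chains_def using assms dominated_mono[OF assms(3)] by blast

lemma bounded_chains_mono:
  assumes "S \<in> bounded_chains F s" "T \<subseteq> S"
  shows "T \<in> bounded_chains F s"
proof -
  have "T \<inter> lev n \<subseteq> S \<inter> lev n" for n
    using assms(2) by blast
  then show ?thesis
    using assms(1) unfolding bounded_chains_def
    by (smt (verit, best) case_prod_unfold dominated_mono mem_Collect_eq order_trans)
qed

lemma closedin_bounded_chains: "closedin powerset_topology (bounded_chains F s)"
  unfolding bounded_chains_def by (rule closedin_locally_determined) (rule finite_lev)

text \<open>The witnesses \<open>p n\<close> for the windows have a subsequence converging to some
  \<open>(f, g)\<close>. It lies in \<open>F\<close> by closedness, and each remaining property at a
  given node or index involves only finitely many coordinates.\<close>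

lemma infinite_bounded_chains:
  assumes F: "closed F" and S: "S \<in> bounded_chains F s" "infinite S"
  obtains f g where "(f, g) \<in> F" "S \<subseteq> branch f" "dominated g S" "\<And>i. i < length s \<Longrightarrow> g i = s ! i"
proof -
  obtain p where p: "\<And>n. p n \<in> F" "\<And>n. S \<inter> lev n \<subseteq> branch (fst (p n))"
      "\<And>n. dominated (snd (p n)) (S \<inter> lev n)" "\<And>n i. i < length s \<Longrightarrow> snd (p n) i = s ! i"
    using S(1) by (simp add: bounded_chains_def case_prod_unfold) metis
  \<comment> \<open>A node \<open>x\<close> of \<open>S\<close> with at least \<open>i\<close>
    shorter ones bounds the second component at \<open>i\<close> once the window contains
    \<open>x\<close>; the first component is boolean.\<close>
  have "\<exists>N. finite ((\<lambda>n. (fst (p n) i, snd (p n) i)) ` {N..})" for i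
  proof -
    obtain Y where Y: "Y \<subseteq> S" "finite Y" "card Y = i"
      using infinite_arbitrarily_large[OF S(2)] by blast
    obtain x where x: "x \<in> S" "Suc (Max (length ` Y)) \<le> length x"
      using infinite_longer[OF S(2)] by blast
    have "Y \<subseteq> {y \<in> S. length y < length x}"
    proof
      fix y
      assume "y \<in> Y"
      then have "length y \<le> Max (length ` Y)"
        using Y(2) by simp
      then show "y \<in> {y \<in> S. length y < length x}"
        using \<open>y \<in> Y\<close> Y(1) x(2) by auto
    qed
    then have i: "i \<le> card {y \<in> S. length y < length x}"
      using Y(3) card_mono[OF finite_shorter] by blast
    have "snd (p n) i \<le> length x" if "Suc (length x) \<le> n" for n
      using dominated_inter_lev[OF p(3)[of n] x(1) _ i] that by simp
    then have "(\<lambda>n. (fst (p n) i, snd (p n) i)) ` {Suc (length x)..} \<subseteq> UNIV \<times> {..length x}"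
      by auto
    moreover have "finite (UNIV \<times> {..length x} :: (bool \<times> nat) set)"
      by (intro finite_cartesian_product finite finite_atMost)
    ultimately have "finite ((\<lambda>n. (fst (p n) i, snd (p n) i)) ` {Suc (length x)..})"
      by (rule finite_subset)
    then show ?thesis ..
  qed
  then obtain w where w: "\<And>m. infinite {n. \<forall>i<m. (fst (p n) i, snd (p n) i) = w i}"
    using agreeing_subsequence[of "\<lambda>n i. (fst (p n) i, snd (p n) i)"] by blast
  define f g where "f = fst \<circ> w" and "g = snd \<circ> w"
  \<comment> \<open>Agreement with the limit occurs at arbitrarily late \<open>n\<close>, so the
    window can be taken to contain any given node.\<close>
  have late: "\<exists>n\<ge>N. \<forall>i<m. fst (p n) i = f i \<and> snd (p n) i = g i" for N m
  proof -
    obtain n where "n \<ge> N" "\<forall>i<m. (fst (p n) i, snd (p n) i) = w i"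
      using w[of m] unfolding infinite_nat_iff_unbounded_le by blast
    then show ?thesis
      by (metis comp_apply f_def fst_conv g_def snd_conv)
  qed
  show ?thesis
  proof
    show "(f, g) \<in> F"
    proof (rule closed_agreement[OF F])
      show "\<exists>(f', g')\<in>F. \<forall>i<n. f' i = f i \<and> g' i = g i" for n
      proof -
        obtain m where "\<forall>i<n. fst (p m) i = f i \<and> snd (p m) i = g i"
          using late[of 0 n] by (elim exE conjE)
        then show ?thesis
          using p(1)[of m] by (intro bexI[of _ "p m"]) (simp_all add: case_prod_unfold)
      qed
    qed
    show "S \<subseteq> branch f"
    proof
      fix x
      assume "x \<in> S"
      obtain n where n: "n \<ge> Suc (length x)" "\<forall>i<length x. fst (p n) i = f i"
        using late by blast
      then have "x \<in> branch (fst (p n))"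
        using p(2)[of n] \<open>x \<in> S\<close> by (auto simp: lev_def)
      then show "x \<in> branch f"
        using n(2) by (simp add: branch_iff)
    qed
    show "dominated g S"
      unfolding dominated_def
    proof (intro ballI allI impI)
      fix x i
      assume x: "x \<in> S" "i \<le> card {y \<in> S. length y < length x}"
      obtain n where n: "n \<ge> Suc (length x)" "snd (p n) i = g i"
        using late[of "Suc (length x)" "Suc i"] by blast
      then show "g i \<le> length x"
        using dominated_inter_lev[OF p(3)[of n] x(1) _ x(2)] by simp
    qed
    show "g i = s ! i" if "i < length s" for i
      using late[of 0 "Suc i"] p(4) that by (metis lessI)
  qed
qed

lemma infinite_in_bounded_chains_iff:
  assumes "closed F" "infinite S"
  shows "S \<in> bounded_chains F [] \<longleftrightarrow> S \<in> B_family F"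
proof
  assume "S \<in> bounded_chains F []"
  then obtain f g where "(f, g) \<in> F" "S \<subseteq> branch f" "dominated g S"
    using infinite_bounded_chains[OF assms(1) _ assms(2)] by metis
  then show "S \<in> B_family F"
    using assms(2) dominated_iff_le_Enum unfolding B_family_def by blast
next
  assume "S \<in> B_family F"
  then obtain f g where "S \<subseteq> branch f" "(f, g) \<in> F" "g \<le> Enum f S"
    by (auto simp: B_family_def)
  then show "S \<in> bounded_chains F []"
    using assms(2) dominated_iff_le_Enum by (intro bounded_chainsI[of f g]) auto
qed

section \<open>The ideal\<close>

text \<open>\<open>ideal_closed\<close> is preserved by arbitrary intersections, so the hull
  inherits it.\<close>

lemma ideal_closed_generated: "ideal_closed (generated_ideal G)"
  unfolding generated_ideal_def by (rule hull_in) (auto simp: ideal_closed_def)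

text \<open>The right side is closed under the ideal operations and contains the generators.
  Conversely, finite members of \<open>?D\<close> lie in every ideal, and infinite bounded chains
  belong to \<open>B_family F\<close>.\<close>

lemma J_ideal_eq:
  assumes "closed F"
  shows "J_ideal F = (\<Union>k. unions (antichains \<union> bounded_chains F []) {} k)"
    (is "_ = (\<Union>k. unions ?D {} k)")
proof
  have mono: "\<forall>S\<in>?D. Pow S \<subseteq> ?D"
    using antichains_mono bounded_chains_mono by blast
  have D: "S \<in> unions ?D {} (Suc 0)" if "S \<in> ?D" for S
    using that by (auto simp: unions_Suc)
  have "S \<in> (\<Union>k. unions ?D {} k)" if "finite S" for S
    using that
  proof (induction S)
    case empty
    have "{} \<in> unions ?D {} 0"
      by simp
    then show ?case
      by blast
  next
    case (insert x S)
    then obtain k where "S \<in> unions ?D {} k"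
      by blast
    moreover have "{x} \<in> unions ?D {} (Suc 0)"
      by (intro D) (simp add: antichains_def)
    ultimately have "{x} \<union> S \<in> unions ?D {} (Suc 0 + k)"
      by (intro unions_Un)
    then show ?case
      by auto
  qed
  moreover have "T \<in> (\<Union>k. unions ?D {} k)" if "S \<in> (\<Union>k. unions ?D {} k)" "T \<subseteq> S" for S T
  proof -
    obtain k where "S \<in> unions ?D {} k"
      using \<open>S \<in> (\<Union>k. unions ?D {} k)\<close> by blast
    from unions_mono[OF mono this \<open>T \<subseteq> S\<close>] show ?thesis
      by blast
  qed
  moreover have "S \<union> T \<in> (\<Union>k. unions ?D {} k)"
    if "S \<in> (\<Union>k. unions ?D {} k)" "T \<in> (\<Union>k. unions ?D {} k)" for S T
    using that unions_Un[of S ?D "{}" _ T] by blast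
  ultimately have "ideal_closed (\<Union>k. unions ?D {} k)"
    unfolding ideal_closed_def by simp
  moreover have "antichains \<union> B_family F \<subseteq> (\<Union>k. unions ?D {} k)"
    using D infinite_in_bounded_chains_iff[OF assms] unfolding B_family_def by blast
  ultimately show "J_ideal F \<subseteq> (\<Union>k. unions ?D {} k)"
    unfolding J_ideal_def generated_ideal_def by (intro hull_minimal)
next
  have J: "ideal_closed (J_ideal F)"
    unfolding J_ideal_def by (rule ideal_closed_generated)
  have gen: "antichains \<union> B_family F \<subseteq> J_ideal F"
    unfolding J_ideal_def generated_ideal_def by (rule hull_subset)
  have D: "S \<in> J_ideal F" if "S \<in> ?D" for S
  proof (cases "finite S")
    case True
    then show ?thesis
      using J by (simp add: ideal_closed_def)
  next
    case False
    then show ?thesis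
      using that gen infinite_in_bounded_chains_iff[OF assms] by blast
  qed
  have "S \<in> J_ideal F" if "S \<in> unions ?D {} k" for S k
    using that
  proof (induction k arbitrary: S)
    case 0
    then show ?case
      using J by (simp add: ideal_closed_def)
  next
    case (Suc k)
    then obtain P Q where "S = P \<union> Q" "P \<in> ?D" "Q \<in> unions ?D {} k"
      unfolding unions_Suc by blast
    then show ?case
      using D[of P] Suc.IH[of Q] J by (simp add: ideal_closed_def)
  qed
  then show "(\<Union>k. unions ?D {} k) \<subseteq> J_ideal F"
    by blast
qed

section \<open>Complexity, properness and tallness\<close>

lemma fsigma_in_J_ideal:
  assumes "closed F"
  shows "fsigma_in powerset_topology (J_ideal F)"
  unfolding J_ideal_eq[OF assms]
  by (intro fsigma_in_Union countableI_type)
    (auto intro!: closed_imp_fsigma_in closedin_unions closedin_Un closedin_antichains closedin_bounded_chains)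

lemma J_ideal_proper:
  assumes "closed F"
  shows "UNIV \<notin> J_ideal F"
proof
  \<comment> \<open>The invariant of the induction: \<open>H\<close> collects the branches that
    carry an infinite chain among the parts. The whole tree violates it, having infinitely many
    infinite branches.\<close>
  have "\<exists>H. finite H \<and> (\<forall>f. f \<notin> H \<longrightarrow> finite (S \<inter> branch f))"
    if "S \<in> unions (antichains \<union> bounded_chains F []) {} k" for S k
    using that
  proof (induction k arbitrary: S)
    case (Suc k)
    then obtain P Q where PQ: "S = P \<union> Q" "P \<in> antichains \<union> bounded_chains F []"
        "Q \<in> unions (antichains \<union> bounded_chains F []) {} k"
      by (auto simp: unions_Suc)
    obtain H where H: "finite H" "\<And>f. f \<notin> H \<Longrightarrow> finite (Q \<inter> branch f)"
      using Suc.IH[OF PQ(3)] by blast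
    show ?case
    proof (cases "P \<in> antichains \<or> finite P")
      case True
      then show ?thesis
        using H PQ(1) finite_antichain_inter_branch by (intro exI[of _ H]) (auto simp: Int_Un_distrib2)
    next
      case False
      then obtain h where "P \<subseteq> branch h"
        using infinite_bounded_chains[OF assms] PQ(2) by (metis UnE)
      then have "finite (P \<inter> branch f)" if "f \<noteq> h" for f
        using finite_subset[OF _ finite_branch_inter[OF that]] by blast
      then show ?thesis
        using H PQ(1) by (intro exI[of _ "insert h H"]) (auto simp: Int_Un_distrib2)
    qed
  qed auto
  moreover assume "UNIV \<in> J_ideal F"
  ultimately obtain H where "finite H" "\<And>f. f \<notin> H \<Longrightarrow> finite (branch f)"
    unfolding J_ideal_eq[OF assms] by (metis (no_types, lifting) Int_UNIV_left UN_iff)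
  moreover have "infinite (UNIV :: (nat \<Rightarrow> bool) set)"
    using finite_fun_UNIVD1[where 'a = nat and 'b = bool] by auto
  ultimately show False
    using infinite_branch by (metis UNIV_eq_I)
qed

lemma tall_J_ideal:
  assumes "closed F" "fst ` F = UNIV"
  shows "tall (J_ideal F)"
  unfolding tall_def
proof (intro allI impI)
  have gen: "antichains \<union> B_family F \<subseteq> J_ideal F"
    unfolding J_ideal_def generated_ideal_def by (rule hull_subset)
  fix X :: "bool list set"
  assume "infinite X"
  then show "\<exists>Y. Y \<subseteq> X \<and> infinite Y \<and> Y \<in> J_ideal F"
  proof (cases rule: infinite_chain_or_antichain)
    case (1 Y)
    then show ?thesis
      using gen by blast
  next
    case (2 Y f)
    have "f \<in> fst ` F"
      using assms(2) by simp
    then obtain g where g: "(f, g) \<in> F"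
      by force
    obtain S where S: "S \<subseteq> Y" "infinite S" "dominated g S"
      using exists_dominated_subset[OF 2(2,3)] by blast
    then have "S \<in> bounded_chains F []"
      using g 2(3) by (intro bounded_chainsI) auto
    then show ?thesis
      using S 2(1) gen infinite_in_bounded_chains_iff[OF assms(1)] by blast
  qed
qed

section \<open>From a Borel selector to a Borel uniformization\<close>

lemma J_ideal_inter_branch:
  assumes "closed F" "S \<in> J_ideal F" "S \<subseteq> branch f"
  obtains N k where "S \<in> unions (bounded_chains F []) (lev N) k"
proof -
  have "\<exists>N l. S \<in> unions (bounded_chains F []) (lev N) l"
    if "S \<in> unions (antichains \<union> bounded_chains F []) {} k" "S \<subseteq> branch f" for S k
    using that
  proof (induction k arbitrary: S)
    case 0
    then have "S \<in> unions (bounded_chains F []) (lev 0) 0"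
      by simp
    then show ?case
      by blast
  next
    case (Suc k)
    then obtain P Q where PQ: "S = P \<union> Q" "P \<in> antichains \<union> bounded_chains F []"
        "Q \<in> unions (antichains \<union> bounded_chains F []) {} k"
      by (auto simp: unions_Suc)
    then obtain N l where Q: "Q \<in> unions (bounded_chains F []) (lev N) l"
      using Suc.IH[OF PQ(3)] Suc.prems(2) by auto
    show ?case
    proof (cases "P \<in> antichains")
      case True
      \<comment> \<open>An antichain part inside a branch is finite and moves into the base, leaving
        only bounded chains as parts.\<close>
      then have "finite P"
        using finite_antichain_inter_branch[of P f] Suc.prems(2) PQ(1) by (simp add: Int_absorb2)
      then obtain M where "P \<subseteq> lev M"
        using finite_subset_lev by blast
      then have "P \<union> Q \<in> unions (bounded_chains F []) (lev (max M N)) l"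
        by (intro unions_Un_base[OF Q]) (auto simp: lev_def)
      then show ?thesis
        using PQ(1) by blast
    next
      case False
      then have "S \<in> unions (bounded_chains F []) (lev N) (Suc l)"
        using PQ Q by (auto simp: unions_Suc)
      then show ?thesis
        by blast
    qed
  qed
  then show ?thesis
    using assms that unfolding J_ideal_eq[OF assms(1)] by blast
qed

lemma borel_selector_imp_uniformization:
  assumes F: "closed F" and sel: "borel_selector (J_ideal F) \<phi>"
  shows "admits_borel_uniformization F"
proof -
  define S where "S f = \<phi> (branch f)" for f
  have S: "S f \<subseteq> branch f" "infinite (S f)" "S f \<in> J_ideal F" for f
    using sel infinite_branch by (auto simp: S_def borel_selector_def selector_def)
  have "branch \<in> borel \<rightarrow>\<^sub>M restrict_space powerset_borel {S. infinite S}"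
    using measurable_branch infinite_branch by (intro measurable_restrict_space2) auto
  from measurable_compose[OF this] sel
  have "S \<in> borel \<rightarrow>\<^sub>M restrict_space powerset_borel (J_ideal F)"
    unfolding S_def borel_selector_def by blast
  then have "S \<in> borel \<rightarrow>\<^sub>M powerset_borel"
    by (simp add: measurable_restrict_space2_iff)
  then have meas: "Measurable.pred borel (\<lambda>f. S f \<in> Z)" if "closedin powerset_topology Z" for Z
    using measurable_sets[OF _ closedin_imp_sets_powerset_borel[OF that], of S borel]
    by (simp add: pred_def vimage_def)
  \<comment> \<open>Unions of \<open>k\<close> bounded chains up to an error inside
    \<open>lev N\<close>.\<close>
  define E where "E = (\<lambda>k N. unions (bounded_chains F []) (lev N) k)"
  have closedin_E: "closedin powerset_topology (E k N)" for k N
    unfolding E_def by (intro closedin_unions closedin_bounded_chains)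
  \<comment> \<open>\<open>Suc (k f)\<close> is the minimal number of chains over all finite errors;
    it is positive because \<open>S f\<close> is infinite, as \<open>not_E_0\<close> records.
    \<open>N f\<close> is then a sufficient error level, chosen least to be measurable.\<close>
  define k where "k f = (LEAST k. \<exists>N. S f \<in> E (Suc k) N)" for f
  define N where "N f = (LEAST N. S f \<in> E (Suc (k f)) N)" for f
  have not_E_0: "S f \<notin> E 0 N" for f N
    using S(2) finite_lev finite_subset by (auto simp: E_def)
  have "\<exists>k N. S f \<in> E (Suc k) N" for f
  proof -
    obtain N k where "S f \<in> E k N"
      using J_ideal_inter_branch[OF F S(3,1)] unfolding E_def by blast
    then show ?thesis
      using not_E_0 by (cases k) auto
  qed
  then have k: "\<exists>N. S f \<in> E (Suc (k f)) N" for f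
    unfolding k_def by (rule LeastI_ex)
  then have N: "S f \<in> E (Suc (k f)) (N f)" for f
    unfolding N_def by (rule LeastI_ex)
  have k_least: "S f \<notin> E (k f) N" for f N
  proof (cases "k f")
    case (Suc j)
    then show ?thesis
      using not_less_Least[of j "\<lambda>k. \<exists>N. S f \<in> E (Suc k) N"] by (auto simp: k_def)
  qed (simp add: not_E_0)
  \<comment> \<open>A finite \<open>T\<close> would be absorbed by the base, leaving a decomposition
    into only \<open>k f\<close> chains.\<close>
  have infinite_part: "infinite T" if "S f = T \<union> R" "R \<in> E (k f) N" for f T R N
  proof
    assume "finite T"
    then obtain M where "T \<subseteq> lev M"
      using finite_subset_lev by blast
    then have "T \<union> R \<in> E (k f) (max M N)"
      using that(2) unfolding E_def by (intro unions_Un_base[of R _ "lev N"]) (auto simp: lev_def)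
    then show False
      using that(1) k_least[of f "max M N"] by simp
  qed
  \<comment> \<open>One chain is singled out to carry the prescribed segment \<open>s\<close>; the
    other \<open>k f\<close> chains and the error go into \<open>E\<close>. For fixed
    \<open>k f\<close> and \<open>N f\<close> this is a closed condition on
    \<open>S f\<close>.\<close>
  define good where "good f s \<longleftrightarrow> S f \<in> join (bounded_chains F s) (E (k f) (N f))" for f s
  have good_iff: "good f s \<longleftrightarrow> (\<exists>T R g. S f = T \<union> R \<and> R \<in> E (k f) (N f) \<and> T \<subseteq> branch f \<and> dominated g T \<and>
      (f, g) \<in> F \<and> (\<forall>i<length s. g i = s ! i))" for f s
  proof
    assume "good f s"
    then obtain T R where TR: "S f = T \<union> R" "T \<in> bounded_chains F s" "R \<in> E (k f) (N f)"
      by (auto simp: good_def join_def)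
    have T: "infinite T"
      using infinite_part TR by blast
    obtain f' g where g: "(f', g) \<in> F" "T \<subseteq> branch f'" "dominated g T" "\<And>i. i < length s \<Longrightarrow> g i = s ! i"
      using infinite_bounded_chains[OF F TR(2) T] by blast
    have "T \<subseteq> branch f"
      using S(1) TR(1) by blast
    \<comment> \<open>Distinct branches share only finitely many nodes, whereas \<open>T\<close> is
      infinite.\<close>
    then have "f' = f"
      using T g(2) finite_branch_inter[of f' f] by (metis finite_subset le_inf_iff)
    then show "\<exists>T R g. S f = T \<union> R \<and> R \<in> E (k f) (N f) \<and> T \<subseteq> branch f \<and> dominated g T \<and>
      (f, g) \<in> F \<and> (\<forall>i<length s. g i = s ! i)"
      using TR g by blast
  next
    assume "\<exists>T R g. S f = T \<union> R \<and> R \<in> E (k f) (N f) \<and> T \<subseteq> branch f \<and> dominated g T \<and>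
      (f, g) \<in> F \<and> (\<forall>i<length s. g i = s ! i)"
    then obtain T R g where "S f = T \<union> R" "R \<in> E (k f) (N f)" "T \<subseteq> branch f" "dominated g T"
        "(f, g) \<in> F" "\<forall>i<length s. g i = s ! i"
      by blast
    moreover from this have "T \<in> bounded_chains F s"
      by (intro bounded_chainsI[of f g]) auto
    ultimately show "good f s"
      by (auto simp: good_def join_def)
  qed
  have "Measurable.pred borel (\<lambda>f. good f s)" for s
  proof -
    have k_meas: "k \<in> borel \<rightarrow>\<^sub>M count_space UNIV"
      unfolding k_def using meas[OF closedin_E] by (intro measurable_Least pred_intros_countable)
    have "(\<lambda>f. LEAST N. S f \<in> E (Suc j) N) \<in> borel \<rightarrow>\<^sub>M count_space UNIV" for j
      using meas[OF closedin_E] by (intro measurable_Least)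
    from measurable_compose_countable[OF this k_meas]
    have N_meas: "N \<in> borel \<rightarrow>\<^sub>M count_space UNIV"
      unfolding N_def .
    \<comment> \<open>The parameters are fixed as \<open>j\<close> and \<open>M\<close> first;
      \<open>k f\<close> and \<open>N f\<close> take countably many values and are substituted
      afterwards.\<close>
    have "Measurable.pred borel (\<lambda>f. S f \<in> join (bounded_chains F s) (E j M))" for j M
      by (intro meas closedin_join closedin_bounded_chains closedin_E)
    from measurable_compose_countable[OF measurable_compose_countable[OF this N_meas] k_meas]
    show ?thesis
      unfolding good_def .
  qed
  moreover have "good f []" for f
    using N[of f] by (auto simp: good_def join_def E_def unions_Suc)
  \<comment> \<open>The same decomposition and the same \<open>g\<close> serve for the longer
    segment, with \<open>g (length s)\<close> as next entry.\<close>
  moreover have "\<exists>j. good f (s @ [j])" if "good f s" for f s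
  proof -
    obtain T R g where TRg: "S f = T \<union> R" "R \<in> E (k f) (N f)" "T \<subseteq> branch f" "dominated g T"
        "(f, g) \<in> F" "\<forall>i<length s. g i = s ! i"
      using good_iff[THEN iffD1, OF \<open>good f s\<close>] by (elim exE conjE)
    moreover have "\<forall>i<length (s @ [g (length s)]). g i = (s @ [g (length s)]) ! i"
      using TRg(6) by (simp add: nth_append less_Suc_eq)
    ultimately show ?thesis
      unfolding good_iff by blast
  qed
  ultimately obtain u where u: "u \<in> borel_measurable borel" "\<And>f n. good f (map (u f) [0..<n])"
    using measurable_leaf[of good borel] by metis
  \<comment> \<open>The \<open>g\<close> that witnesses a segment of \<open>u f\<close> may change
    with its length; closedness of \<open>F\<close> passes to the limit.\<close>
  have "(f, u f) \<in> F" for f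
  proof (rule closed_agreement[OF F])
    fix n
    obtain g where "(f, g) \<in> F" "\<forall>i<length (map (u f) [0..<n]). g i = map (u f) [0..<n] ! i"
      using u(2)[of f n] unfolding good_iff by blast
    then show "\<exists>(f', g')\<in>F. \<forall>i<n. f' i = f i \<and> g' i = u f i"
      by auto
  qed
  then show ?thesis
    using u(1) unfolding admits_borel_uniformization_def by blast
qed

theorem proposition0p2:
  fixes F :: "((nat \<Rightarrow> bool) \<times> (nat \<Rightarrow> nat)) set"
  assumes "closed F"
    and "fst ` F = UNIV"
    and "\<not> admits_borel_uniformization F"
  shows "set_ideal (J_ideal F) \<and> fsigma_in powerset_topology (J_ideal F) \<and> tall (J_ideal F) \<and>
    \<not> (\<exists>\<phi>. borel_selector (J_ideal F) \<phi>)"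
  using ideal_closed_generated J_ideal_proper[OF assms(1)] fsigma_in_J_ideal[OF assms(1)]
    tall_J_ideal[OF assms(1,2)] borel_selector_imp_uniformization[OF assms(1)] assms(3)
  unfolding set_ideal_def J_ideal_def by blast

end
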